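(* Let $H$ be an infinite dimensional complex separable Hilbert space and let $K=SA\in\mathcal{L}(H)$ be a symmetrizable operator, with $A\in\mathcal{L}(H)$ self-adjoint and $S>0$ compact. Assume that all non-zero eigenvalues $\lambda_j$, $j\ge0$, of $K$ are simple and that $K$ is injective. Then a vector $\xi\in H$ is $K^*$-cyclic if and only if $$\langle\xi,g_j\rangle\neq0\quad\text{for all } j\ge0 .$$ Similarly, a vector $\eta\in H$ is $K$-cyclic if and only if $$\langle\eta,f_j\rangle\ne0\quad\text{for all } j\ge0 .$$
   Context: $S>0$ means $S$ is self-adjoint with $\langle Sx,x\rangle>0$ for all $x\ne0$. The operator $K=SA$ satisfies $SK^*=KS$ (i.e. it is symmetrizable by $S$); the non-zero eigenvalues of $K$ and $K^*$ coincide and are real. $f_j$, $g_j$ are eigenvectors $K^*f_j=\lambda_jf_j$, $g_j=Sf_j$, $Kg_j=\lambda_jg_j$, normalized by $\langle f_k,g_j\rangle=\delta_{kj}$, the $\lambda_j$ running through all non-zero eigenvalues. A vector $\xi$ is $T$-cyclic if the closed linear span of $\{T^n\xi: n\ge0\}$ is $H$. *)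

theory Defs
  imports "HOL-Analysis.Analysis"
begin

section \<open>Complex Hilbert spaces\<close>

class complex_vector = real_vector +
  fixes scaleC :: "complex \<Rightarrow> 'a \<Rightarrow> 'a"  (infixr "*\<^sub>C" 75)
  assumes scaleC_add_right: "c *\<^sub>C (x + y) = c *\<^sub>C x + c *\<^sub>C y"
    and scaleC_add_left: "(c + d) *\<^sub>C x = c *\<^sub>C x + d *\<^sub>C x"
    and scaleC_scaleC: "c *\<^sub>C (d *\<^sub>C x) = (c * d) *\<^sub>C x"
    and scaleC_of_real: "complex_of_real r *\<^sub>C x = r *\<^sub>R x"

global_interpretation complex_vector: vector_space "scaleC :: complex \<Rightarrow> 'a \<Rightarrow> 'a :: complex_vector"
  defines cspan = complex_vector.span
    and cdim = complex_vector.dim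
proof unfold_locales
  show "1 *\<^sub>C x = x" for x :: 'a
    using scaleC_of_real[of 1 x] by simp
qed (simp_all add: scaleC_add_right scaleC_add_left scaleC_scaleC)

text \<open>
  The complex inner product is linear in its first argument. Its real part is
  the library's real inner product of the underlying real space; positive definiteness,
  the norm \<open>norm x = sqrt (Re (cinner x x))\<close> and the topology are inherited from there.
\<close>

class complex_inner = complex_vector + real_inner +
  fixes cinner :: "'a \<Rightarrow> 'a \<Rightarrow> complex"
  assumes cinner_commute: "cinner x y = cnj (cinner y x)"
    and cinner_add_left: "cinner (x + y) z = cinner x z + cinner y z"
    and cinner_scaleC_left: "cinner (c *\<^sub>C x) y = c * cinner x y"
    and Re_cinner: "Re (cinner x y) = inner x y"

class chilbert_space = complex_inner + complete_space

definition infinite_dimensional :: "'a::complex_vector itself \<Rightarrow> bool" where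
  "infinite_dimensional _ \<longleftrightarrow> \<not> (\<exists>B :: 'a set. finite B \<and> cspan B = UNIV)"


section \<open>Operators\<close>

definition bounded_clinear :: "('a::complex_inner \<Rightarrow> 'a) \<Rightarrow> bool" where
  "bounded_clinear T \<longleftrightarrow> bounded_linear T \<and> (\<forall>c x. T (c *\<^sub>C x) = c *\<^sub>C T x)"

definition compact_operator :: "('a::complex_inner \<Rightarrow> 'a) \<Rightarrow> bool" where
  "compact_operator T \<longleftrightarrow> bounded_clinear T \<and> compact (closure (T ` cball 0 1))"

definition selfadjoint :: "('a::complex_inner \<Rightarrow> 'a) \<Rightarrow> bool" where
  "selfadjoint T \<longleftrightarrow> bounded_clinear T \<and> (\<forall>x y. cinner (T x) y = cinner x (T y))"

text \<open>For self-adjoint \<open>T\<close> the number \<open>cinner (T x) x\<close> is real.\<close>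

definition positive_operator :: "('a::complex_inner \<Rightarrow> 'a) \<Rightarrow> bool" where
  "positive_operator T \<longleftrightarrow> selfadjoint T \<and> (\<forall>x. x \<noteq> 0 \<longrightarrow> Re (cinner (T x) x) > 0)"

text \<open>Meaningful for bounded operators on a Hilbert space, which have exactly one adjoint.\<close>

definition cadjoint :: "('a::complex_inner \<Rightarrow> 'a) \<Rightarrow> ('a \<Rightarrow> 'a)" where
  "cadjoint T = (THE T'. \<forall>x y. cinner (T x) y = cinner x (T' y))"

definition symmetrizable_by :: "('a::complex_inner \<Rightarrow> 'a) \<Rightarrow> ('a \<Rightarrow> 'a) \<Rightarrow> bool" where
  "symmetrizable_by S K \<longleftrightarrow> S \<circ> cadjoint K = K \<circ> S"


section \<open>Eigenvalues and cyclic vectors\<close>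

definition eigenspace :: "('a::complex_vector \<Rightarrow> 'a) \<Rightarrow> complex \<Rightarrow> 'a set" where
  "eigenspace T c = {x. T x = c *\<^sub>C x}"

definition eigenvector :: "('a::complex_vector \<Rightarrow> 'a) \<Rightarrow> complex \<Rightarrow> 'a \<Rightarrow> bool" where
  "eigenvector T c x \<longleftrightarrow> x \<noteq> 0 \<and> T x = c *\<^sub>C x"

definition eigenvalue :: "('a::complex_vector \<Rightarrow> 'a) \<Rightarrow> complex \<Rightarrow> bool" where
  "eigenvalue T c \<longleftrightarrow> (\<exists>x. eigenvector T c x)"

text \<open>
  Simplicity is geometric. For non-zero eigenvalues of an operator \<open>S \<circ> A\<close> with \<open>A\<close> self-adjoint
  and \<open>S\<close> positive it coincides with algebraic simplicity, since
  \<open>ker ((K - c)\<^sup>2) = ker (K - c)\<close> there.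
\<close>

definition simple_eigenvalue :: "('a::complex_vector \<Rightarrow> 'a) \<Rightarrow> complex \<Rightarrow> bool" where
  "simple_eigenvalue T c \<longleftrightarrow> eigenvalue T c \<and> cdim (eigenspace T c) = 1"

definition cyclic_vector :: "('a::complex_inner \<Rightarrow> 'a) \<Rightarrow> 'a \<Rightarrow> bool" where
  "cyclic_vector T \<xi> \<longleftrightarrow> closure (cspan (range (\<lambda>n::nat. (T ^^ n) \<xi>))) = UNIV"


section \<open>The adjoint of a product \<open>S \<circ> A\<close>\<close>

lemma cadjoint_eqI:
  fixes T :: "'a::complex_inner \<Rightarrow> 'a"
  assumes "\<And>x y. cinner (T x) y = cinner x (T' y)"
  shows "cadjoint T = T'"
  unfolding cadjoint_def
proof (rule the_equality)
  fix U assume U: "\<forall>x y. cinner (T x) y = cinner x (U y)"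
  show "U = T'"
  proof
    fix y
    have "inner x (U y) = inner x (T' y)" for x
      using U assms[of x y] by (metis Re_cinner)
    then have "inner (U y - T' y) (U y - T' y) = 0"
      by (simp add: inner_diff_right)
    then show "U y = T' y" by simp
  qed
qed (use assms in blast)

lemma cadjoint_selfadjoint_comp:
  assumes "selfadjoint S" "selfadjoint A"
  shows "cadjoint (S \<circ> A) = A \<circ> S"
  by (rule cadjoint_eqI) (use assms in \<open>simp add: selfadjoint_def\<close>)

lemma symmetrizable_by_comp:
  assumes "selfadjoint S" "selfadjoint A"
  shows "symmetrizable_by S (S \<circ> A)"
  by (simp add: symmetrizable_by_def cadjoint_selfadjoint_comp[OF assms] o_assoc)

text \<open>The images under \<open>S\<close> of eigenvectors of \<open>K\<^sup>*\<close> are eigenvectors of \<open>K\<close>.\<close>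

lemma eigenvector_symmetrizable:
  assumes S: "positive_operator S" and "symmetrizable_by S K"
    and f: "eigenvector (cadjoint K) c f"
  shows "eigenvector K c (S f)"
proof -
  have "K (S f) = S (cadjoint K f)"
    using assms(2) unfolding symmetrizable_by_def by (metis comp_apply)
  also have "\<dots> = c *\<^sub>C S f"
    using f S by (simp add: eigenvector_def positive_operator_def selfadjoint_def bounded_clinear_def)
  finally have "K (S f) = c *\<^sub>C S f" .
  moreover have "S f \<noteq> 0"
  proof
    assume "S f = 0"
    then have "Re (cinner (S f) f) = 0" by (simp add: Re_cinner)
    with S f show False by (auto simp: positive_operator_def eigenvector_def)
  qed
  ultimately show ?thesis by (simp add: eigenvector_def)
qed

end

theory Submission
  imports Defs
begin

text \<open>
  A vector is cyclic iff its orbit has trivial annihilator \<open>M\<close>, and \<open>M\<close> is a closed subspace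
  invariant under the adjoint. Hence it suffices that every non-zero closed subspace invariant under
  \<open>K = S A\<close> (resp. \<open>K\<^sup>* = A S\<close>) contains an eigenvector; by simplicity this is a multiple of some
  \<open>g j\<close> (resp. \<open>f j\<close>). The operator \<open>A S\<close> is symmetric for the inner product \<open>\<langle>S u, v\<rangle>\<close> and leaves
  \<open>A M\<close> (resp. \<open>M\<close>) invariant, so the eigenvector arises by maximizing \<open>\<langle>A S u, S u\<rangle>\<close> on
  \<open>\<langle>S u, u\<rangle> = 1\<close> there, with the compactness of \<open>S\<close> giving convergence of \<open>S u\<close>.
\<close>

section \<open>Real inner product spaces\<close>

text \<open>For \<open>r > 0\<close> the claim is the hypothesis at the minimizer
  \<open>t = - q / r\<close>. Negative \<open>r\<close>, and \<open>r = 0\<close> with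
  \<open>q\<close> non-zero, would make the polynomial negative somewhere.\<close>

lemma discriminant_nonpos:
  fixes p q r :: real
  assumes "\<And>t. 0 \<le> p + 2 * t * q + t\<^sup>2 * r"
  shows "q\<^sup>2 \<le> p * r"
proof (cases "r = 0")
  case True
  have "q = 0"
  proof (rule ccontr)
    assume "q \<noteq> 0"
    then have "2 * (- (p + 1) / (2 * q)) * q = - (p + 1)" by simp
    then show False using assms[of "- (p + 1) / (2 * q)"] True by simp
  qed
  then show ?thesis using True by simp
next
  case False
  have "r \<ge> 0"
  proof (rule ccontr)
    assume "\<not> r \<ge> 0"
    then have r: "r < 0" by simp
    have p: "p \<ge> 0" using assms[of 0] by simp
    \<comment> \<open>Adding the hypothesis at \<open>t\<close> and \<open>- t\<close> cancels the
      linear term; the \<open>t\<close> chosen next brings the sum to \<open>-2\<close>.\<close>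
    have "0 \<le> 2 * p + 2 * t\<^sup>2 * r" for t
      using assms[of t] assms[of "- t"] by simp
    from this[of "sqrt ((p + 1) / - r)"] have "0 \<le> 2 * p + 2 * ((p + 1) / - r) * r"
      using p r by (simp add: divide_nonneg_neg real_sqrt_pow2_iff)
    then show False using r by simp
  qed
  with False have r: "r > 0" by simp
  have "0 \<le> p - q\<^sup>2 / r"
    using assms[of "- q / r"] r by (simp add: field_simps power2_eq_square)
  then show ?thesis using r by (simp add: field_simps)
qed

section \<open>Closed subspaces and vectors orthogonal to them\<close>

lemma subspace_closure:
  fixes V :: "'a::real_normed_vector set"
  assumes "subspace V"
  shows "subspace (closure V)"
proof (rule subspaceI)
  show "0 \<in> closure V" using assms closure_subset subspace_0 by blast
next
  fix x y assume "x \<in> closure V" "y \<in> closure V"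
  then obtain a b where "\<And>n. a n \<in> V" "a \<longlonglongrightarrow> x" "\<And>n. b n \<in> V" "b \<longlonglongrightarrow> y"
    unfolding closure_sequential by blast
  then show "x + y \<in> closure V"
    unfolding closure_sequential
    by (intro exI[of _ "\<lambda>n. a n + b n"]) (simp add: assms subspace_add tendsto_add)
next
  fix c x assume "x \<in> closure V"
  then obtain a where "\<And>n. a n \<in> V" "a \<longlonglongrightarrow> x" unfolding closure_sequential by blast
  then show "c *\<^sub>R x \<in> closure V"
    unfolding closure_sequential
    by (intro exI[of _ "\<lambda>n. c *\<^sub>R a n"]) (simp add: assms subspace_scale tendsto_scaleR)
qed

text \<open>The vector is \<open>x - y\<close>, where \<open>x\<close> lies outside \<open>W\<close>
  and \<open>y\<close> is its nearest point in \<open>W\<close>, obtained by completeness as the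
  limit of a minimizing sequence.\<close>

lemma ex_orthogonal_to_closed_subspace:
  fixes W :: "'a::{real_inner, complete_space} set"
  assumes W: "subspace W" and cl: "closed W" and "W \<noteq> UNIV"
  shows "\<exists>v. v \<noteq> 0 \<and> (\<forall>w\<in>W. inner w v = 0)"
proof -
  obtain x where x: "x \<notin> W" using \<open>W \<noteq> UNIV\<close> by blast
  define N where "N w = (norm (x - w))\<^sup>2" for w
  define d where "d = Inf (N ` W)"
  have bdd: "bdd_below (N ` W)" by (intro bdd_belowI[of _ 0]) (auto simp: N_def)
  have ne: "N ` W \<noteq> {}" using subspace_0[OF W] by blast
  have d_le: "d \<le> N w" if "w \<in> W" for w
    unfolding d_def using bdd that by (intro cInf_lower) auto
  have "\<exists>w\<in>W. N w < d + 1 / real (Suc n)" for n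
  proof -
    have "Inf (N ` W) < d + 1 / real (Suc n)" by (simp add: d_def)
    then show ?thesis using cInf_less_iff[OF ne bdd] by blast
  qed
  then obtain w where wW: "\<And>n. w n \<in> W" and wN: "\<And>n. N (w n) < d + 1 / real (Suc n)"
    by metis
  \<comment> \<open>Parallelogram law: the midpoint of \<open>u\<close> and \<open>v\<close> lies in
    \<open>W\<close>, so its squared distance to \<open>x\<close> is at least \<open>d\<close>. This
    makes minimizing sequences Cauchy.\<close>
  have par: "(norm (u - v))\<^sup>2 \<le> 2 * (N u - d) + 2 * (N v - d)" if "u \<in> W" "v \<in> W" for u v
  proof -
    have "(1/2) *\<^sub>R (u + v) \<in> W" using that W by (simp add: subspace_add subspace_scale)
    from d_le[OF this] have "d \<le> N ((1/2) *\<^sub>R (u + v))" .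
    moreover have "(norm (u - v))\<^sup>2 = 2 * N u + 2 * N v - 4 * N ((1/2) *\<^sub>R (u + v))"
      by (simp add: N_def power2_norm_eq_inner inner_diff_left inner_diff_right inner_add_left
          inner_add_right inner_commute algebra_simps)
    ultimately show ?thesis by simp
  qed
  have "Cauchy w"
  proof (rule metric_CauchyI)
    fix e :: real assume "e > 0"
    then obtain k where k: "1 / real (Suc k) < e\<^sup>2 / 4"
      using nat_approx_posE[of "e\<^sup>2 / 4"] by auto
    have "dist (w m) (w n) < e" if "m \<ge> k" "n \<ge> k" for m n
    proof -
      have *: "N (w i) - d < e\<^sup>2 / 4" if "i \<ge> k" for i
      proof -
        have "1 / real (Suc i) \<le> 1 / real (Suc k)" using that by (simp add: frac_le)
        then show ?thesis using wN[of i] k by linarith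
      qed
      have "(norm (w m - w n))\<^sup>2 < e\<^sup>2"
        using par[OF wW[of m] wW[of n]] *[OF that(1)] *[OF that(2)] by argo
      then show ?thesis
        using \<open>e > 0\<close> by (simp add: dist_norm power_less_imp_less_base)
    qed
    then show "\<exists>M. \<forall>m\<ge>M. \<forall>n\<ge>M. dist (w m) (w n) < e" by blast
  qed
  then obtain y where y: "w \<longlonglongrightarrow> y" using Cauchy_convergent convergent_def by blast
  have yW: "y \<in> W" by (rule closed_sequentially[OF cl wW y])
  have "(\<lambda>n. N (w n)) \<longlonglongrightarrow> N y" unfolding N_def by (intro tendsto_intros y)
  moreover have "(\<lambda>n. d + 1 / real (Suc n)) \<longlonglongrightarrow> d + 0"
    by (intro tendsto_intros LIMSEQ_Suc lim_1_over_n)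
  ultimately have "N y \<le> d" using wN by (intro LIMSEQ_le) (auto intro: less_imp_le)
  have "inner u (x - y) = 0" if "u \<in> W" for u
  proof -
    \<comment> \<open>Minimality of \<open>y\<close> along the line in direction \<open>u\<close>,
      written with \<open>p = 0\<close> so that the discriminant bound forces the linear coefficient
      to vanish.\<close>
    have "0 \<le> 0 + 2 * t * - inner u (x - y) + t\<^sup>2 * inner u u" for t
    proof -
      have "y + t *\<^sub>R u \<in> W" using W yW that by (simp add: subspace_add subspace_scale)
      then have "N y \<le> N (y + t *\<^sub>R u)" using d_le \<open>N y \<le> d\<close> by fastforce
      then show ?thesis
        unfolding N_def power2_norm_eq_inner
        by (simp add: inner_diff_left inner_diff_right inner_add_left inner_add_right
            inner_commute algebra_simps power2_eq_square)
    qed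
    from discriminant_nonpos[OF this] show ?thesis by simp
  qed
  moreover have "x - y \<noteq> 0" using x yW by auto
  ultimately show ?thesis by blast
qed

text \<open>Positivity is asked on \<open>L\<close> only, because the form built below from the
  supremum over \<open>L\<close> is known to be semidefinite only there.\<close>

lemma psd_Cauchy_Schwarz:
  fixes S :: "'a::real_inner \<Rightarrow> 'a"
  assumes "linear S" and sym: "\<And>x y. inner (S x) y = inner x (S y)"
    and L: "subspace L" and pos: "\<And>x. x \<in> L \<Longrightarrow> inner (S x) x \<ge> 0"
    and "x \<in> L" "y \<in> L"
  shows "(inner (S x) y)\<^sup>2 \<le> inner (S x) x * inner (S y) y"
proof (rule discriminant_nonpos)
  fix t
  interpret linear S by fact
  have "inner (S y) x = inner (S x) y" by (metis sym inner_commute)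
  moreover have "0 \<le> inner (S (x + t *\<^sub>R y)) (x + t *\<^sub>R y)"
    using L \<open>x \<in> L\<close> \<open>y \<in> L\<close> by (intro pos) (simp add: subspace_add subspace_scale)
  ultimately show "0 \<le> inner (S x) x + 2 * t * inner (S x) y + t\<^sup>2 * inner (S y) y"
    by (simp add: add scale inner_add_left inner_add_right power2_eq_square algebra_simps)
qed

text \<open>Cauchy-Schwarz for the form of \<open>S\<close> at \<open>x\<close> and
  \<open>S x\<close>, divided by the squared norm of \<open>S x\<close>. It controls
  \<open>S x\<close> by the form alone, without a bound on \<open>x\<close>.\<close>

lemma psd_norm_sq_le:
  fixes S :: "'a::real_inner \<Rightarrow> 'a"
  assumes "bounded_linear S" and sym: "\<And>x y. inner (S x) y = inner x (S y)"
    and pos: "\<And>x. inner (S x) x \<ge> 0"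
  shows "(norm (S x))\<^sup>2 \<le> onorm S * inner (S x) x"
proof (cases "S x = 0")
  case False
  have "((norm (S x))\<^sup>2)\<^sup>2 \<le> inner (S x) x * inner (S (S x)) (S x)"
    using psd_Cauchy_Schwarz[OF bounded_linear.linear[OF assms(1)] sym subspace_UNIV, of x "S x"] pos
    by (simp add: power2_norm_eq_inner)
  also have "inner (S (S x)) (S x) \<le> onorm S * (norm (S x))\<^sup>2"
  proof -
    have "inner (S (S x)) (S x) \<le> norm (S (S x)) * norm (S x)" by (rule norm_cauchy_schwarz)
    also have "\<dots> \<le> (onorm S * norm (S x)) * norm (S x)"
      by (intro mult_right_mono onorm assms(1)) simp
    finally show ?thesis by (simp add: power2_eq_square)
  qed
  finally have "((norm (S x))\<^sup>2)\<^sup>2 \<le> inner (S x) x * (onorm S * (norm (S x))\<^sup>2)"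
    using pos by (simp add: mult_left_mono)
  then have "(norm (S x))\<^sup>2 * (norm (S x))\<^sup>2 \<le> (onorm S * inner (S x) x) * (norm (S x))\<^sup>2"
    by (simp add: power2_eq_square mult_ac)
  then show ?thesis by (rule mult_right_le_imp_le) (use False in simp)
qed (simp add: inner_commute)


section \<open>Eigenvectors of symmetrizable operators\<close>

text \<open>
  A maximizing sequence \<open>u\<close> need not converge, since \<open>\<langle>S u, v\<rangle>\<close> is an incomplete inner product;
  only \<open>S \<circ> u\<close> does, along a subsequence. With \<open>a\<close> the supremum, Cauchy-Schwarz for the
  semidefinite form \<open>\<langle>S (a - A S) u, v\<rangle>\<close> on \<open>L\<close> shows \<open>(a - S A) (S u) \<longlonglongrightarrow> 0\<close>.
\<close>

lemma symmetrizable_eigenvector_aux: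
  fixes S A :: "'a::real_inner \<Rightarrow> 'a"
  assumes S: "bounded_linear S" and Ssym: "\<And>x y. inner (S x) y = inner x (S y)"
    and Spos: "\<And>x. x \<noteq> 0 \<Longrightarrow> inner (S x) x > 0"
    and comp: "compact (closure (S ` cball 0 1))"
    and A: "bounded_linear A" and Asym: "\<And>x y. inner (A x) y = inner x (A y)"
    and L: "subspace L" and inv: "\<And>u. u \<in> L \<Longrightarrow> A (S u) \<in> L"
    and ex: "\<exists>u\<in>L. inner (A (S u)) (S u) > 0"
  shows "\<exists>a w u. a > 0 \<and> w \<noteq> 0 \<and> S (A w) = a *\<^sub>R w \<and> (\<forall>n::nat. u n \<in> L) \<and> (\<lambda>n. S (u n)) \<longlonglongrightarrow> w"
proof -
  interpret S: bounded_linear S by fact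
  interpret A: bounded_linear A by fact
  define q where "q u = inner (A (S u)) (S u)" for u
  define U where "U = {u \<in> L. inner (S u) u = 1}"
  define a where "a = Sup (q ` U)"
  define C where "C = onorm A * onorm S"
  have S0: "inner (S x) x \<ge> 0" for x using Spos[of x] by (cases "x = 0") auto
  have nS: "(norm (S x))\<^sup>2 \<le> onorm S * inner (S x) x" for x
    by (rule psd_norm_sq_le[OF S Ssym S0])
  have qC: "\<bar>q u\<bar> \<le> C * inner (S u) u" for u
  proof -
    have "\<bar>q u\<bar> \<le> norm (A (S u)) * norm (S u)" unfolding q_def by (rule Cauchy_Schwarz_ineq2)
    also have "\<dots> \<le> (onorm A * norm (S u)) * norm (S u)"
      by (intro mult_right_mono onorm A) simp
    also have "\<dots> = onorm A * (norm (S u))\<^sup>2" by (simp add: power2_eq_square)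
    also have "\<dots> \<le> onorm A * (onorm S * inner (S u) u)"
      by (intro mult_left_mono nS onorm_pos_le A)
    finally show ?thesis by (simp add: C_def mult.assoc)
  qed
  have bdd: "bdd_above (q ` U)"
  proof (rule bdd_aboveI2)
    show "q u \<le> C" if "u \<in> U" for u using qC[of u] that by (simp add: U_def)
  qed
  have q_scale: "q (t *\<^sub>R u) = t\<^sup>2 * q u" for t u
    by (simp add: q_def S.scaleR A.scaleR power2_eq_square)
  have unit: "(1 / sqrt (inner (S u) u)) *\<^sub>R u \<in> U" "q ((1 / sqrt (inner (S u) u)) *\<^sub>R u) = q u / inner (S u) u"
    if "u \<in> L" "u \<noteq> 0" for u
  proof -
    show "(1 / sqrt (inner (S u) u)) *\<^sub>R u \<in> U"
      using that L Spos[of u] by (simp add: U_def subspace_scale S.scaleR)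
    show "q ((1 / sqrt (inner (S u) u)) *\<^sub>R u) = q u / inner (S u) u"
      using Spos[of u] that by (simp add: q_scale power_divide)
  qed
  have q_le: "q u \<le> a * inner (S u) u" if "u \<in> L" for u
  proof (cases "u = 0")
    case False
    have "q u / inner (S u) u \<le> a"
      unfolding a_def using unit[OF that False] bdd by (metis cSup_upper imageI)
    then show ?thesis using Spos[OF False] by (simp add: field_simps)
  qed (simp add: q_def S.zero A.zero)
  obtain u0 where u0: "u0 \<in> L" "q u0 > 0" using ex by (auto simp: q_def)
  then have u00: "u0 \<noteq> 0" by (auto simp: q_def S.zero)
  have a: "a > 0"
  proof -
    have "0 < a * inner (S u0) u0" using q_le[OF u0(1)] u0(2) by linarith
    then show ?thesis using Spos[OF u00] zero_less_mult_pos2 by blast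
  qed
  have ne: "q ` U \<noteq> {}" using unit(1)[OF u0(1) u00] by blast
  have "\<exists>u\<in>U. a - 1 / real (Suc n) < q u" for n
  proof -
    have "a - 1 / real (Suc n) < Sup (q ` U)" by (simp add: a_def)
    then show ?thesis using less_cSup_iff[OF ne bdd] by blast
  qed
  then obtain u where uU: "\<And>n. u n \<in> U" and uq: "\<And>n. a - 1 / real (Suc n) < q (u n)"
    by metis
  have uL: "u n \<in> L" and u1: "inner (S (u n)) (u n) = 1" for n using uU by (auto simp: U_def)
  have q_lim: "(\<lambda>n. q (u n)) \<longlonglongrightarrow> a"
  proof (rule tendsto_sandwich)
    have "(\<lambda>n. a - 1 / real (Suc n)) \<longlonglongrightarrow> a - 0"
      by (intro tendsto_intros LIMSEQ_Suc lim_1_over_n)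
    then show "(\<lambda>n. a - 1 / real (Suc n)) \<longlonglongrightarrow> a" by simp
    show "\<forall>\<^sub>F n in sequentially. a - 1 / real (Suc n) \<le> q (u n)"
      using uq by (simp add: less_imp_le)
    show "\<forall>\<^sub>F n in sequentially. q (u n) \<le> a" using q_le[OF uL] u1 by simp
  qed simp

  \<comment> \<open>\<open>D\<close> is \<open>a - A S\<close>. The form of \<open>F = S D\<close>
    is the gap \<open>a <S x, x> - q x\<close>, which is non-negative on \<open>L\<close> and tends
    to 0 along \<open>u\<close>.\<close>
  define D where "D x = a *\<^sub>R x - A (S x)" for x
  define F where "F x = S (D x)" for x
  have DL: "D x \<in> L" if "x \<in> L" for x
    using that L inv by (simp add: D_def subspace_diff subspace_scale)
  have linF: "linear F"
    by (rule linearI) (simp_all add: F_def D_def S.add A.add S.diff A.diff S.scaleR A.scaleR algebra_simps)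
  have symF: "inner (F x) y = inner x (F y)" for x y
    by (simp add: F_def D_def S.diff S.scaleR inner_diff_left inner_diff_right Ssym Asym)
  have Fq: "inner (F x) x = a * inner (S x) x - q x" for x
    by (simp add: F_def D_def q_def S.diff S.scaleR inner_diff_left Ssym)
  \<comment> \<open>Cauchy-Schwarz for \<open>F\<close> at \<open>x\<close> and \<open>D x\<close>:
    the mixed term is \<open><S (D x), D x>\<close>, and the second diagonal term is at most
    \<open>a + C\<close> times the same number, which then cancels.\<close>
  have D_le: "inner (S (D x)) (D x) \<le> (a + C) * (a * inner (S x) x - q x)" if "x \<in> L" for x
  proof (cases "D x = 0")
    case True
    then show ?thesis
      using q_le[OF that] a onorm_pos_le[OF A] onorm_pos_le[OF S] by (simp add: S.zero C_def)
  next
    case False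
    let ?s = "inner (S (D x)) (D x)"
    have "(inner (F x) (D x))\<^sup>2 \<le> inner (F x) x * inner (F (D x)) (D x)"
      by (rule psd_Cauchy_Schwarz[OF linF symF L]) (use q_le that DL in \<open>auto simp: Fq\<close>)
    also have "\<dots> \<le> inner (F x) x * ((a + C) * ?s)"
    proof (rule mult_left_mono)
      show "inner (F (D x)) (D x) \<le> (a + C) * ?s"
        using qC[of "D x"] by (simp add: Fq[of "D x"] algebra_simps)
      show "0 \<le> inner (F x) x" using q_le[OF that] by (simp add: Fq)
    qed
    finally have "?s * ?s \<le> ((a + C) * inner (F x) x) * ?s"
      by (simp add: F_def power2_eq_square mult_ac)
    then have "?s \<le> (a + C) * inner (F x) x" using Spos[OF False] by simp
    then show ?thesis by (simp add: Fq)
  qed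
  define w where "w n = S (u n)" for n
  have "(\<lambda>n. (norm (F (u n)))\<^sup>2) \<longlonglongrightarrow> 0"
  proof (rule tendsto_sandwich[where f = "\<lambda>_. 0"])
    show "\<forall>\<^sub>F n in sequentially. (norm (F (u n)))\<^sup>2 \<le> onorm S * ((a + C) * (a - q (u n)))"
    proof (rule always_eventually, rule allI)
      fix n
      have "(norm (F (u n)))\<^sup>2 \<le> onorm S * inner (S (D (u n))) (D (u n))"
        unfolding F_def by (rule nS)
      also have "\<dots> \<le> onorm S * ((a + C) * (a - q (u n)))"
        using D_le[OF uL, of n] by (intro mult_left_mono onorm_pos_le S) (simp add: u1)
      finally show "(norm (F (u n)))\<^sup>2 \<le> onorm S * ((a + C) * (a - q (u n)))" .
    qed
    have "(\<lambda>n. onorm S * ((a + C) * (a - q (u n)))) \<longlonglongrightarrow> onorm S * ((a + C) * (a - a))"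
      by (intro tendsto_intros q_lim)
    then show "(\<lambda>n. onorm S * ((a + C) * (a - q (u n)))) \<longlonglongrightarrow> 0" by simp
  qed simp_all
  then have "(\<lambda>n. sqrt ((norm (F (u n)))\<^sup>2)) \<longlonglongrightarrow> sqrt 0" by (rule tendsto_real_sqrt)
  then have F0: "(\<lambda>n. F (u n)) \<longlonglongrightarrow> 0" by (simp add: tendsto_norm_zero_iff)
  have Fw: "F (u n) = a *\<^sub>R w n - S (A (w n))" for n
    by (simp add: F_def D_def w_def S.diff S.scaleR)

  \<comment> \<open>A bound for \<open>A (w n)\<close>; the summand 1 makes it strictly positive, so
    that division by it is possible.\<close>
  define b where "b = 1 + onorm A * sqrt (onorm S)"
  have b: "b > 0" using onorm_pos_le[OF A] onorm_pos_le[OF S]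
    by (simp add: b_def add_pos_nonneg)
  have "norm (A (w n)) \<le> b" for n
  proof -
    have "norm (w n) \<le> sqrt (onorm S)"
      using nS[of "u n"] u1[of n] by (simp add: w_def real_le_rsqrt)
    then have "onorm A * norm (w n) \<le> onorm A * sqrt (onorm S)"
      by (intro mult_left_mono onorm_pos_le A)
    then show ?thesis using onorm[OF A, of "w n"] by (simp add: b_def)
  qed
  then have "(1 / b) *\<^sub>R A (w n) \<in> cball 0 1" for n using b by simp
  \<comment> \<open>Compactness is applied to \<open>S (A (w n))\<close>, not to
    \<open>w n = S (u n)\<close>: the normalization \<open><S u, u> = 1\<close> does not bound the
    norm of \<open>u n\<close>.\<close>
  then have "\<forall>n. S ((1 / b) *\<^sub>R A (w n)) \<in> closure (S ` cball 0 1)"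
    by (meson closure_subset imageI subsetD)
  then obtain z r where r: "strict_mono (r :: nat \<Rightarrow> nat)"
    and z: "((\<lambda>n. S ((1 / b) *\<^sub>R A (w n))) \<circ> r) \<longlonglongrightarrow> z"
    using comp unfolding compact_def by metis
  have "(\<lambda>n. b *\<^sub>R S ((1 / b) *\<^sub>R A (w (r n)))) \<longlonglongrightarrow> b *\<^sub>R z"
    using z by (intro tendsto_intros) (simp add: o_def)
  then have z': "(\<lambda>n. S (A (w (r n)))) \<longlonglongrightarrow> b *\<^sub>R z" using b by (simp add: S.scaleR)
  have "(\<lambda>n. F (u (r n))) \<longlonglongrightarrow> 0"
    using LIMSEQ_subseq_LIMSEQ[OF F0 r] by (simp add: o_def)
  \<comment> \<open>Since \<open>a w = F u + S A w\<close> and \<open>F u\<close> tends to 0,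
    convergence passes from \<open>S A w\<close> to \<open>w\<close>.\<close>
  from tendsto_add[OF this z'] have "(\<lambda>n. a *\<^sub>R w (r n)) \<longlonglongrightarrow> b *\<^sub>R z" by (simp add: Fw)
  then have "(\<lambda>n. (1 / a) *\<^sub>R a *\<^sub>R w (r n)) \<longlonglongrightarrow> (1 / a) *\<^sub>R b *\<^sub>R z"
    by (rule tendsto_scaleR[OF tendsto_const])
  then have wl: "(\<lambda>n. w (r n)) \<longlonglongrightarrow> (1 / a) *\<^sub>R b *\<^sub>R z" (is "_ \<longlonglongrightarrow> ?w") using a by simp
  have "(\<lambda>n. S (A (w (r n)))) \<longlonglongrightarrow> S (A ?w)" by (intro S.tendsto A.tendsto wl)
  with z' have "S (A ?w) = b *\<^sub>R z" by (rule LIMSEQ_unique[symmetric])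
  then have eig: "S (A ?w) = a *\<^sub>R ?w" using a by simp
  \<comment> \<open>The limit is non-zero because \<open><A w, w>\<close> inherits the value
    \<open>a > 0\<close> from the maximizing sequence.\<close>
  have "(\<lambda>n. inner (A (w (r n))) (w (r n))) \<longlonglongrightarrow> inner (A ?w) ?w"
    by (intro tendsto_inner A.tendsto wl)
  moreover have "(\<lambda>n. inner (A (w (r n))) (w (r n))) \<longlonglongrightarrow> a"
    using LIMSEQ_subseq_LIMSEQ[OF q_lim r] by (simp add: o_def q_def w_def)
  ultimately have "inner (A ?w) ?w = a" by (rule LIMSEQ_unique)
  then have "?w \<noteq> 0" using a by force
  then show ?thesis
    using a eig wl uL unfolding w_def by (intro exI[of _ a] exI[of _ ?w] exI[of _ "u \<circ> r"]) simp
qed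

text \<open>The preceding lemma applies to \<open>A\<close> or to \<open>- A\<close> unless the
  quadratic form vanishes on \<open>L\<close>. In that case polarizing \<open>u\<close> with
  \<open>v = A S u\<close> gives \<open>2 <S v, v> = 0\<close>, against \<open>v\<close> being
  non-zero. The eigenvector is returned as a limit of vectors \<open>S (u n)\<close> because
  \<open>L\<close> need not be closed.\<close>

lemma symmetrizable_eigenvector:
  fixes S A :: "'a::real_inner \<Rightarrow> 'a"
  assumes S: "bounded_linear S" and Ssym: "\<And>x y. inner (S x) y = inner x (S y)"
    and Spos: "\<And>x. x \<noteq> 0 \<Longrightarrow> inner (S x) x > 0"
    and comp: "compact (closure (S ` cball 0 1))"
    and A: "bounded_linear A" and Asym: "\<And>x y. inner (A x) y = inner x (A y)"
    and L: "subspace L" and inv: "\<And>u. u \<in> L \<Longrightarrow> A (S u) \<in> L"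
    and ex: "\<exists>u\<in>L. A (S u) \<noteq> 0"
  shows "\<exists>a w u. a \<noteq> 0 \<and> w \<noteq> 0 \<and> S (A w) = a *\<^sub>R w \<and> (\<forall>n::nat. u n \<in> L) \<and> (\<lambda>n. S (u n)) \<longlonglongrightarrow> w"
proof -
  interpret S: bounded_linear S by fact
  interpret A: bounded_linear A by fact
  let ?q = "\<lambda>u. inner (A (S u)) (S u)"
  have "\<exists>u\<in>L. ?q u \<noteq> 0"
  proof (rule ccontr)
    assume "\<not> ?thesis"
    then have q0: "?q u = 0" if "u \<in> L" for u using that by blast
    obtain u where u: "u \<in> L" "A (S u) \<noteq> 0" using ex by blast
    let ?v = "A (S u)"
    have v: "?v \<in> L" using u inv by blast
    have "?q (u + ?v) = 0" using u v L by (intro q0) (simp add: subspace_add)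
    then have "inner (A (S u)) (S ?v) + inner (A (S ?v)) (S u) = 0"
      using q0[OF u(1)] q0[OF v] by (simp add: S.add A.add inner_add_left inner_add_right)
    moreover have "inner (A (S ?v)) (S u) = inner (S ?v) ?v" by (simp add: Asym)
    moreover have "inner (A (S u)) (S ?v) = inner (S ?v) ?v" by (simp add: inner_commute)
    ultimately show False using Spos[OF u(2)] by simp
  qed
  then obtain u where u: "u \<in> L" "?q u > 0 \<or> ?q u < 0" by fastforce
  show ?thesis
  proof (cases "?q u > 0")
    case True
    with u(1) have "\<exists>u\<in>L. ?q u > 0" by blast
    from symmetrizable_eigenvector_aux[OF S Ssym Spos comp A Asym L inv this]
    show ?thesis by (metis less_irrefl)
  next
    case False
    have "\<exists>a w u. a > 0 \<and> w \<noteq> 0 \<and> S (- A w) = a *\<^sub>R w \<and> (\<forall>n::nat. u n \<in> L) \<and> (\<lambda>n. S (u n)) \<longlonglongrightarrow> w"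
    proof (rule symmetrizable_eigenvector_aux[OF S Ssym Spos comp bounded_linear_minus[OF A] _ L])
      show "inner (- A x) y = inner x (- A y)" for x y by (simp add: Asym)
      show "- A (S u) \<in> L" if "u \<in> L" for u using that L inv by (simp add: subspace_neg)
      show "\<exists>u\<in>L. 0 < inner (- A (S u)) (S u)" using u False by force
    qed
    then obtain a w u where *: "a > 0" "w \<noteq> 0" "S (- A w) = a *\<^sub>R w" "\<forall>n::nat. u n \<in> L"
      "(\<lambda>n. S (u n)) \<longlonglongrightarrow> w" by blast
    then have "S (A w) = (- a) *\<^sub>R w" by (simp add: S.neg minus_equation_iff[of "S (A w)"])
    then show ?thesis using * by (intro exI[of _ "- a"] exI[of _ w] exI[of _ u]) simp
  qed
qed


section \<open>Cyclic vectors\<close>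

lemma cinner_scaleC_right: "cinner x (c *\<^sub>C y) = cnj c * cinner x y"
  by (metis cinner_commute cinner_scaleC_left complex_cnj_mult)

lemma cinner_add_right: "cinner x (y + z) = cinner x y + cinner x z"
  by (metis cinner_commute cinner_add_left complex_cnj_add)

lemma cinner_zero [simp]: "cinner x 0 = 0" "cinner 0 x = 0"
  using cinner_add_right[of x 0 0] cinner_add_left[of 0 0 x] by simp_all

text \<open>Rotating by the imaginary unit turns the imaginary part into a real inner product, so
  that closedness and orthogonality results carry over from the real space.\<close>

lemma cinner_eq_0_iff: "cinner x y = 0 \<longleftrightarrow> inner x y = 0 \<and> inner (\<i> *\<^sub>C x) y = 0"
proof -
  have "inner (\<i> *\<^sub>C x) y = - Im (cinner x y)"
    by (simp add: Re_cinner[symmetric] cinner_scaleC_left)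
  then show ?thesis by (simp add: complex_eq_iff Re_cinner)
qed

lemma csubspace_imp_subspace: "complex_vector.subspace V \<Longrightarrow> subspace V"
  unfolding complex_vector.subspace_def subspace_def by (metis scaleC_of_real)

lemma csubspace_ortho: "complex_vector.subspace {x. cinner x y = 0}"
  by (auto simp: complex_vector.subspace_def cinner_add_left cinner_scaleC_left)

lemma closed_ortho_right: "closed {y. cinner x y = 0}"
  by (auto simp: cinner_eq_0_iff intro!: closed_Collect_conj closed_Collect_eq continuous_intros)

lemma closed_ortho_left: "closed {x. cinner x y = 0}"
proof -
  have "cinner x y = 0 \<longleftrightarrow> cinner y x = 0" for x by (metis cinner_commute complex_cnj_zero)
  then show ?thesis using closed_ortho_right[of y] by simp
qed

text \<open>If the span is not dense, the real projection argument yields \<open>v\<close>; since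
  the span is stable under the imaginary unit, real orthogonality to it is already complex
  orthogonality.\<close>

lemma dense_cspan_iff:
  fixes X :: "'a::chilbert_space set"
  shows "closure (cspan X) = UNIV \<longleftrightarrow> (\<forall>v. (\<forall>x\<in>X. cinner x v = 0) \<longrightarrow> v = 0)"
proof
  assume dense: "closure (cspan X) = UNIV"
  show "\<forall>v. (\<forall>x\<in>X. cinner x v = 0) \<longrightarrow> v = 0"
  proof (intro allI impI)
    fix v assume "\<forall>x\<in>X. cinner x v = 0"
    then have "cspan X \<subseteq> {x. cinner x v = 0}"
      by (intro complex_vector.span_minimal csubspace_ortho) auto
    then have "closure (cspan X) \<subseteq> {x. cinner x v = 0}"
      by (intro closure_minimal closed_ortho_left)
    then have "cinner v v = 0" using dense by blast
    then show "v = 0" by (simp add: cinner_eq_0_iff)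
  qed
next
  assume *: "\<forall>v. (\<forall>x\<in>X. cinner x v = 0) \<longrightarrow> v = 0"
  show "closure (cspan X) = UNIV"
  proof (rule ccontr)
    assume "closure (cspan X) \<noteq> UNIV"
    moreover have "subspace (closure (cspan X))"
      by (intro subspace_closure csubspace_imp_subspace complex_vector.subspace_span)
    ultimately obtain v where v: "v \<noteq> 0" "\<forall>w\<in>closure (cspan X). inner w v = 0"
      using ex_orthogonal_to_closed_subspace by blast
    have "cinner x v = 0" if "x \<in> X" for x
    proof -
      have "x \<in> cspan X" "\<i> *\<^sub>C x \<in> cspan X"
        using that by (simp_all add: complex_vector.span_base complex_vector.span_scale)
      then show ?thesis using v(2) closure_subset by (fastforce simp: cinner_eq_0_iff)
    qed
    then show False using * v(1) by blast
  qed
qed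

lemma simple_eigenvalue_multiple:
  assumes "simple_eigenvalue T c" "eigenvector T c x" "eigenvector T c y"
  shows "\<exists>k. y = k *\<^sub>C x"
proof -
  obtain B where "B \<subseteq> eigenspace T c" "eigenspace T c \<subseteq> cspan B" "card B = cdim (eigenspace T c)"
    using complex_vector.basis_exists by metis
  moreover obtain b where "B = {b}"
    using calculation assms(1) by (metis card_1_singletonE simple_eigenvalue_def)
  ultimately have "x \<in> cspan {b}" "y \<in> cspan {b}"
    using assms by (auto simp: eigenvector_def eigenspace_def)
  then obtain p q where "x = p *\<^sub>C b" "y = q *\<^sub>C b"
    by (auto simp: complex_vector.span_singleton)
  moreover have "p \<noteq> 0" using calculation assms(2) by (auto simp: eigenvector_def)
  ultimately have "y = (q / p) *\<^sub>C x" by (simp add: scaleC_scaleC)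
  then show ?thesis by blast
qed

section \<open>Cyclicity and invariant subspaces of the adjoint\<close>

lemma funpow_adjoint:
  fixes T U :: "'a::complex_inner \<Rightarrow> 'a"
  assumes "\<And>x y. cinner (T x) y = cinner x (U y)"
  shows "cinner ((T ^^ n) x) y = cinner x ((U ^^ n) y)"
  by (induction n arbitrary: y) (simp_all add: assms funpow_swap1[of U])

lemma funpow_eigenvector:
  assumes "\<And>c x. T (c *\<^sub>C x) = c *\<^sub>C T x" "T x = c *\<^sub>C x"
  shows "(T ^^ n) x = (c ^ n) *\<^sub>C x"
  by (induction n) (simp_all add: assms scaleC_scaleC mult_ac)

text \<open>Treats both halves of the theorem at once, with \<open>U\<close> the adjoint of
  \<open>T\<close>. The annihilator \<open>M\<close> of the orbit is closed and
  \<open>U\<close>-invariant, and contains \<open>e j\<close> exactly when \<open>\<xi>\<close> is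
  orthogonal to \<open>e j\<close>, since powers of \<open>U\<close> only rescale
  \<open>e j\<close>. By \<open>inv\<close>, \<open>M\<close> is trivial iff it contains no
  \<open>e j\<close>.\<close>

lemma cyclic_vector_iff:
  fixes T U :: "'a::chilbert_space \<Rightarrow> 'a"
  assumes adj: "\<And>x y. cinner (T x) y = cinner x (U y)"
    and hom: "\<And>c x. U (c *\<^sub>C x) = c *\<^sub>C U x"
    and e: "\<And>j. eigenvector U (c j) (e j)"
    and inv: "\<And>M j. \<lbrakk>complex_vector.subspace M; closed M; \<And>v. v \<in> M \<Longrightarrow> U v \<in> M; M \<noteq> {0}\<rbrakk> \<Longrightarrow> \<exists>j. e j \<in> M"
  shows "cyclic_vector T \<xi> \<longleftrightarrow> (\<forall>j. cinner \<xi> (e j) \<noteq> 0)"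
proof -
  define M where "M = {v. \<forall>n. cinner ((T ^^ n) \<xi>) v = 0}"
  have cyc: "cyclic_vector T \<xi> \<longleftrightarrow> M \<subseteq> {0}"
    by (auto simp: cyclic_vector_def dense_cspan_iff M_def)
  have ejM: "e j \<in> M \<longleftrightarrow> cinner \<xi> (e j) = 0" for j
  proof
    assume "e j \<in> M"
    then show "cinner \<xi> (e j) = 0" by (auto simp: M_def dest: spec[of _ 0])
  next
    assume "cinner \<xi> (e j) = 0"
    then show "e j \<in> M"
      using e[of j] unfolding M_def
      by (auto simp: funpow_adjoint[OF adj] funpow_eigenvector[OF hom] cinner_scaleC_right
          eigenvector_def)
  qed
  have sub: "complex_vector.subspace M"
    by (auto simp: M_def complex_vector.subspace_def cinner_add_right cinner_scaleC_right)
  have "M = (\<Inter>n. {v. cinner ((T ^^ n) \<xi>) v = 0})" by (auto simp: M_def)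
  then have cl: "closed M" by (auto intro: closed_ortho_right)
  have MU: "U v \<in> M" if "v \<in> M" for v
  proof -
    have "cinner ((T ^^ n) \<xi>) (U v) = 0" for n
      using that adj[of "(T ^^ n) \<xi>" v] by (auto simp: M_def dest: spec[of _ "Suc n"])
    then show ?thesis by (simp add: M_def)
  qed
  have "M \<subseteq> {0} \<longleftrightarrow> (\<forall>j. e j \<notin> M)"
    using inv[OF sub cl MU] e complex_vector.subspace_0[OF sub] unfolding eigenvector_def by blast
  then show ?thesis by (simp add: cyc ejM)
qed

theorem proposition4p4:
  fixes K S A :: "'a::chilbert_space \<Rightarrow> 'a"
    and lam :: "nat \<Rightarrow> complex"
    and f g :: "nat \<Rightarrow> 'a"
  assumes "infinite_dimensional TYPE('a)"
    and "separable_space (euclidean :: 'a topology)"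
    and "selfadjoint A"
    and "positive_operator S" and "compact_operator S"
    and "K = S \<circ> A"
    and "inj K"
    and "bij_betw lam UNIV {c. c \<noteq> 0 \<and> eigenvalue K c}"
    and "\<And>j. simple_eigenvalue K (lam j)"
    and "\<And>j. eigenvector (cadjoint K) (lam j) (f j)"
    and "\<And>j. g j = S (f j)"
    and "\<And>k j. cinner (f k) (g j) = (if k = j then 1 else 0)"
  shows "(\<forall>\<xi>. cyclic_vector (cadjoint K) \<xi> \<longleftrightarrow> (\<forall>j. cinner \<xi> (g j) \<noteq> 0)) \<and>
         (\<forall>\<eta>. cyclic_vector K \<eta> \<longleftrightarrow> (\<forall>j. cinner \<eta> (f j) \<noteq> 0))"
proof -
  note Asa = assms(3) and Spo = assms(4)
  have Ssa: "selfadjoint S" using Spo by (simp add: positive_operator_def)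
  have S: "bounded_linear S" and A: "bounded_linear A"
    and Sc: "S (c *\<^sub>C x) = c *\<^sub>C S x" and Ac: "A (c *\<^sub>C x) = c *\<^sub>C A x"
    and Scadj: "cinner (S x) y = cinner x (S y)" and Acadj: "cinner (A x) y = cinner x (A y)"
    for c x y
    using Ssa Asa by (simp_all add: selfadjoint_def bounded_clinear_def)
  interpret S: bounded_linear S by (rule S)
  interpret A: bounded_linear A by (rule A)
  have Ssym: "inner (S x) y = inner x (S y)" and Asym: "inner (A x) y = inner x (A y)" for x y
    by (metis Re_cinner Scadj, metis Re_cinner Acadj)
  have Spos: "inner (S x) x > 0" if "x \<noteq> 0" for x
    using Spo that by (simp add: positive_operator_def Re_cinner)
  have comp: "compact (closure (S ` cball 0 1))"
    using assms(5) by (simp add: compact_operator_def)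
  have S0: "S x = 0 \<Longrightarrow> x = 0" for x using Spos[of x] by force
  have A0: "A x = 0 \<Longrightarrow> x = 0" for x
    using injD[OF assms(7), of x 0] by (simp add: assms(6) S.zero A.zero)
  have Sinj: "S x = S y \<Longrightarrow> x = y" for x y using S0[of "x - y"] by (simp add: S.diff)
  have Kadj: "cadjoint K = A \<circ> S"
    unfolding assms(6) by (rule cadjoint_selfadjoint_comp[OF Ssa Asa])
  have Kg: "eigenvector K (lam j) (g j)" for j
    unfolding assms(11)
    by (rule eigenvector_symmetrizable[OF Spo _ assms(10)])
      (simp add: assms(6) symmetrizable_by_comp[OF Ssa Asa])
  \<comment> \<open>Shared by both halves: injectivity of \<open>S\<close> and \<open>A\<close>
    makes the eigenvector lemma applicable, the eigenvalue found is some \<open>lam j\<close>, and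
    simplicity identifies the eigenvector up to a factor with \<open>g j\<close>.\<close>
  have key: "\<exists>k j u. k \<noteq> 0 \<and> (\<forall>n::nat. u n \<in> L) \<and> (\<lambda>n. S (u n)) \<longlonglongrightarrow> k *\<^sub>C g j"
    if L: "subspace L" "\<And>u. u \<in> L \<Longrightarrow> A (S u) \<in> L" "\<exists>u\<in>L. u \<noteq> 0" for L
  proof -
    have "\<exists>u\<in>L. A (S u) \<noteq> 0" using L(3) S0 A0 by blast
    from symmetrizable_eigenvector[OF S Ssym Spos comp A Asym L(1,2) this]
    obtain a w u where a: "a \<noteq> 0" "w \<noteq> 0" "S (A w) = a *\<^sub>R w" and u: "\<forall>n::nat. u n \<in> L"
      "(\<lambda>n. S (u n)) \<longlonglongrightarrow> w" by blast
    have w: "eigenvector K (complex_of_real a) w"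
      using a by (simp add: eigenvector_def assms(6) scaleC_of_real)
    then have "complex_of_real a \<in> {c. c \<noteq> 0 \<and> eigenvalue K c}"
      using a by (auto simp: eigenvalue_def)
    then obtain j where j: "complex_of_real a = lam j"
      using assms(8) unfolding bij_betw_def by (metis rangeE)
    obtain k where k: "w = k *\<^sub>C g j"
      using simple_eigenvalue_multiple[OF assms(9) Kg] w j by metis
    moreover have "k \<noteq> 0" using k a(2) by auto
    ultimately show ?thesis using u by blast
  qed
  have lam0: "lam j \<noteq> 0" for j using assms(8) unfolding bij_betw_def by blast
  have Ag: "A (g j) = lam j *\<^sub>C f j" for j
    using assms(10)[of j] by (simp add: Kadj eigenvector_def assms(11))
  have unscale: "x \<in> M" if "complex_vector.subspace M" "k *\<^sub>C x \<in> M" "k \<noteq> 0" for M k and x :: 'a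
    using complex_vector.subspace_scale[OF that(1,2), of "1 / k"] that(3) by (simp add: scaleC_scaleC)

  have "cyclic_vector (cadjoint K) \<xi> \<longleftrightarrow> (\<forall>j. cinner \<xi> (g j) \<noteq> 0)" for \<xi>
  proof (rule cyclic_vector_iff[where U = K, OF _ _ Kg])
    show "cinner (cadjoint K x) y = cinner x (K y)" for x y
      unfolding Kadj by (simp add: assms(6) Acadj Scadj)
    show "K (c *\<^sub>C x) = c *\<^sub>C K x" for c x by (simp add: assms(6) Sc Ac)
    fix M assume M: "complex_vector.subspace M" "closed M" "\<And>v. v \<in> M \<Longrightarrow> K v \<in> M" "M \<noteq> {0}"
    \<comment> \<open>\<open>L = A M\<close> is chosen because \<open>S\<close> maps it back into
      \<open>M\<close>: \<open>S (A v) = K v\<close>. Hence the limit \<open>k *\<^sub>C g j\<close>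
      lies in the closed set \<open>M\<close>.\<close>
    have "subspace (A ` M)"
      by (intro linear_subspace_image A.linear_axioms csubspace_imp_subspace M(1))
    moreover have "A (S u) \<in> A ` M" if "u \<in> A ` M" for u
      using that M(3) by (auto simp: assms(6))
    moreover have "\<exists>u\<in>A ` M. u \<noteq> 0"
      using M(4) A0 complex_vector.subspace_0[OF M(1)] by blast
    ultimately obtain k j u where k: "k \<noteq> 0" "\<forall>n::nat. u n \<in> A ` M"
      "(\<lambda>n. S (u n)) \<longlonglongrightarrow> k *\<^sub>C g j" using key by blast
    have "S (u n) \<in> M" for n
    proof -
      obtain v where "v \<in> M" "u n = A v" using k(2) by blast
      then show ?thesis using M(3)[of v] by (simp add: assms(6))
    qed
    then have "k *\<^sub>C g j \<in> M" by (rule closed_sequentially[OF M(2) _ k(3)])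
    then show "\<exists>j. g j \<in> M" using unscale M(1) k(1) by blast
  qed
  moreover have "cyclic_vector K \<eta> \<longleftrightarrow> (\<forall>j. cinner \<eta> (f j) \<noteq> 0)" for \<eta>
  proof (rule cyclic_vector_iff[where U = "cadjoint K", OF _ _ assms(10)])
    show "cinner (K x) y = cinner x (cadjoint K y)" for x y
      unfolding Kadj by (simp add: assms(6) Acadj Scadj)
    show "cadjoint K (c *\<^sub>C x) = c *\<^sub>C cadjoint K x" for c x by (simp add: Kadj Sc Ac)
    fix M assume M: "complex_vector.subspace M" "closed M" "\<And>v. v \<in> M \<Longrightarrow> cadjoint K v \<in> M" "M \<noteq> {0}"
    have "\<exists>u\<in>M. u \<noteq> 0" using M(4) complex_vector.subspace_0[OF M(1)] by blast
    moreover have "A (S u) \<in> M" if "u \<in> M" for u using M(3)[OF that] by (simp add: Kadj)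
    ultimately obtain k j u where k: "k \<noteq> 0" "\<forall>n::nat. u n \<in> M"
      "(\<lambda>n. S (u n)) \<longlonglongrightarrow> k *\<^sub>C g j" using key[OF csubspace_imp_subspace[OF M(1)]] by blast
    \<comment> \<open>Here \<open>L = M\<close>, but the limit is a multiple of \<open>g j\<close>,
      with no claim that it lies in \<open>M\<close>. Applying \<open>A\<close> moves the sequence
      into \<open>M\<close> and its limit to a non-zero multiple of \<open>f j\<close>.\<close>
    have "A (S (u n)) \<in> M" for n using M(3)[of "u n"] k(2) by (simp add: Kadj)
    then have "A (k *\<^sub>C g j) \<in> M" by (rule closed_sequentially[OF M(2) _ A.tendsto[OF k(3)]])
    then have "(k * lam j) *\<^sub>C f j \<in> M" by (simp add: Ac Ag scaleC_scaleC)
    then show "\<exists>j. f j \<in> M" using unscale M(1) k(1) lam0 by (metis no_zero_divisors)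
  qed
  ultimately show ?thesis by blast
qed

end
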